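(* Let $G$ be a nontrivial connected graph. Then: (a) $pvc(G)=0$ if and only if $G$ is a complete graph; (b) $pvc(G)=1$ if and only if $diam(G)=2$.
   Context: All graphs are simple, finite and undirected; nontrivial means having at least two vertices. Vertex-colorings are arbitrary (adjacent vertices may receive the same color). A path in a vertex-colored graph is a vertex-proper path if any two adjacent internal vertices of the path differ in color (the end-vertices of the path are not internal). A vertex-colored graph is proper vertex-connected if any two distinct vertices are joined by a vertex-proper path. For a connected graph $G$, $pvc(G)$ is the smallest number of colors required to make $G$ proper vertex-connected. The value $0$ is allowed: $pvc(G)=0$ means that no vertex needs to be colored, where an uncolored path counts as vertex-proper exactly when it has no internal vertices. $diam(G)$ is the maximum distance between two vertices of $G$. *)

theory Defs
  imports "Graph_Theory.Graph_Theory"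
begin

text \<open>
  A simple finite undirected graph is a symmetric digraph in the sense of the locale
  \<^locale>\<open>graph\<close>: finite, without loops and without parallel arcs, every edge being
  represented by its two opposite arcs.
\<close>

text \<open>
  \<open>None\<close> leaves every vertex uncolored (zero colors); \<open>Some f\<close> colors every vertex,
  with no constraint on adjacent vertices.
\<close>
type_synonym 'a vertex_coloring = "('a \<Rightarrow> nat) option"

definition num_colors :: "('a, 'b) pre_digraph \<Rightarrow> 'a vertex_coloring \<Rightarrow> nat" where
  "num_colors G c = (case c of None \<Rightarrow> 0 | Some f \<Rightarrow> card (f ` verts G))"

text \<open>
  Adjacency of internal vertices refers to the path, i.e. to consecutive internal vertices.
  An uncolored path is vertex-proper exactly when it has no internal vertices.
\<close>
definition vertex_proper_path ::
    "('a, 'b) pre_digraph \<Rightarrow> 'a vertex_coloring \<Rightarrow> 'a \<Rightarrow> 'b awalk \<Rightarrow> 'a \<Rightarrow> bool" where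
  "vertex_proper_path G c u p v \<longleftrightarrow>
     pre_digraph.apath G u p v \<and>
     (case c of
        None \<Rightarrow> pre_digraph.inner_verts G p = []
      | Some f \<Rightarrow> distinct_adj (map f (pre_digraph.inner_verts G p)))"

definition proper_vertex_connected ::
    "('a, 'b) pre_digraph \<Rightarrow> 'a vertex_coloring \<Rightarrow> bool" where
  "proper_vertex_connected G c \<longleftrightarrow>
     (\<forall>u \<in> verts G. \<forall>v \<in> verts G. u \<noteq> v \<longrightarrow> (\<exists>p. vertex_proper_path G c u p v))"

text \<open>
  The minimum exists for every finite connected graph: an injective coloring makes it
  proper vertex-connected.
\<close>
definition pvc :: "('a, 'b) pre_digraph \<Rightarrow> nat" where
  "pvc G = (LEAST k. \<exists>c. num_colors G c = k \<and> proper_vertex_connected G c)"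

definition vertex_distance :: "('a, 'b) pre_digraph \<Rightarrow> 'a \<Rightarrow> 'a \<Rightarrow> ereal" where
  "vertex_distance G u v = wf_digraph.\<mu> G (\<lambda>_. 1) u v"

text \<open>For a finite nonempty vertex set the supremum is a maximum.\<close>
definition diam :: "('a, 'b) pre_digraph \<Rightarrow> ereal" where
  "diam G = (SUP (u, v) \<in> verts G \<times> verts G. vertex_distance G u v)"

end

theory Submission
  imports Defs
begin

text \<open>
  A path has one internal vertex fewer than it has arcs. Hence the vertex-proper paths are those
  with at most one arc if no vertex is colored, and those with at most two arcs if all vertices
  share one color, so that \<open>pvc G = 0\<close> iff the diameter is at most 1, and \<open>pvc G \<le> 1\<close> iff the
  diameter is at most 2.
\<close>

text \<open>Under a single color every two consecutive entries clash, so the list must not have two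
  consecutive entries at all.\<close>

lemma distinct_adj_map_const_iff:
  assumes "f ` set xs \<subseteq> {a}"
  shows "distinct_adj (map f xs) \<longleftrightarrow> length xs \<le> 1"
proof (cases xs)
  case (Cons x ys)
  then show ?thesis using assms by (cases ys) auto
qed simp

context wf_digraph
begin

text \<open>The internal vertices are the tails of all arcs but the first. Truncated subtraction
  gives the right value 0 for the empty walk.\<close>

lemma length_inner_verts: "length (inner_verts p) = length p - 1"
  by (simp add: inner_verts_def)

lemma set_inner_verts_subset:
  assumes "apath u p v"
  shows "set (inner_verts p) \<subseteq> verts G"
proof -
  have "set (awalk_verts u p) \<subseteq> verts G"
    using assms by (blast dest: awalkI_apath)
  moreover have "set (inner_verts p) \<subseteq> set (awalk_verts u p)"
    by (auto simp: inner_verts_conv[of p u] dest!: in_set_butlastD list_set_tl)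
  ultimately show ?thesis by blast
qed

lemma vertex_proper_path_None_iff:
  "vertex_proper_path G None u p v \<longleftrightarrow> apath u p v \<and> length p \<le> 1"
  using length_inner_verts[of p] by (auto simp: vertex_proper_path_def simp flip: length_0_conv)

lemma vertex_proper_path_const_iff:
  assumes "f ` verts G = {a}"
  shows "vertex_proper_path G (Some f) u p v \<longleftrightarrow> apath u p v \<and> length p \<le> 2"
proof (cases "apath u p v")
  case True
  then have "f ` set (inner_verts p) \<subseteq> {a}"
    using set_inner_verts_subset assms by blast
  then show ?thesis
    using True by (auto simp: vertex_proper_path_def distinct_adj_map_const_iff length_inner_verts)
qed (simp add: vertex_proper_path_def)

text \<open>A path repeats no vertex, so an injective coloring gives pairwise distinct colors to its
  internal vertices, in particular to neighboring ones.\<close>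

lemma vertex_proper_path_inj:
  assumes "inj_on f (verts G)" "apath u p v"
  shows "vertex_proper_path G (Some f) u p v"
proof -
  have "distinct (inner_verts p)"
    unfolding inner_verts_conv[of p u]
    using assms(2) by (intro distinct_butlast distinct_tl) (simp add: apath_def)
  moreover have "inj_on f (set (inner_verts p))"
    by (rule inj_on_subset[OF assms(1) set_inner_verts_subset[OF assms(2)]])
  ultimately have "distinct_adj (map f (inner_verts p))"
    by (intro distinct_adj_mapI) (simp_all add: distinct_adj_conv_nth distinct_conv_nth)
  then show ?thesis using assms(2) by (simp add: vertex_proper_path_def)
qed

lemma awalk_cost_unit: "awalk_cost (\<lambda>_. 1) p = real (length p)"
  by (induction p) auto

lemma diam_le_iff:
  "diam G \<le> d \<longleftrightarrow> (\<forall>u \<in> verts G. \<forall>v \<in> verts G. vertex_distance G u v \<le> d)"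
  unfolding diam_def by (auto simp: SUP_le_iff)

end

context fin_digraph
begin

text \<open>Unit costs are nonnegative, so a cheapest walk can be chosen to be a path. This makes
  distances of reachable pairs natural numbers.\<close>

lemma vertex_distance_attained:
  assumes "u \<rightarrow>\<^sup>* v"
  obtains p where "apath u p v" "vertex_distance G u v = ereal (real (length p))"
  using min_cost_awalk[OF assms, of "\<lambda>_. 1"] by (auto simp: vertex_distance_def awalk_cost_unit)

lemma vertex_distance_le_iff:
  "vertex_distance G u v \<le> ereal (real n) \<longleftrightarrow> (\<exists>p. apath u p v \<and> length p \<le> n)"
proof
  assume le: "vertex_distance G u v \<le> ereal (real n)"
  \<comment> \<open>The distance of an unreachable pair is \<infinity>, so any finite bound yields
    reachability.\<close>
  then have "vertex_distance G u v < \<infinity>" by auto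
  then have "u \<rightarrow>\<^sup>* v" by (simp only: vertex_distance_def \<mu>_reach_conv)
  then obtain p where "apath u p v" "vertex_distance G u v = ereal (real (length p))"
    by (rule vertex_distance_attained)
  then show "\<exists>p. apath u p v \<and> length p \<le> n" using le by auto
next
  assume "\<exists>p. apath u p v \<and> length p \<le> n"
  then obtain p where "apath u p v" "length p \<le> n" by blast
  moreover have "vertex_distance G u v \<le> ereal (real (length p))"
    using min_cost_le_walk_cost[of u p v "\<lambda>_. 1"] \<open>apath u p v\<close>
    by (simp add: vertex_distance_def awalk_cost_unit apath_def)
  moreover have "ereal (real (length p)) \<le> ereal (real n)"
    using \<open>length p \<le> n\<close> by simp
  ultimately show "vertex_distance G u v \<le> ereal (real n)"
    by (metis order_trans)
qed

lemma diam_le_iff_apath: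
  "diam G \<le> ereal (real n) \<longleftrightarrow>
    (\<forall>u \<in> verts G. \<forall>v \<in> verts G. u \<noteq> v \<longrightarrow> (\<exists>p. apath u p v \<and> length p \<le> n))"
proof -
  \<comment> \<open>The empty path settles equal end-vertices, which proper vertex-connection leaves
    out but the supremum in \<open>diam\<close> includes.\<close>
  have "\<exists>p. apath u p u \<and> length p \<le> n" if "u \<in> verts G" for u
    using that by (intro exI[of _ "[]"]) (simp add: apath_Nil_iff)
  then show ?thesis unfolding diam_le_iff vertex_distance_le_iff by metis
qed

lemma proper_vertex_connected_None_iff: "proper_vertex_connected G None \<longleftrightarrow> diam G \<le> 1"
  using diam_le_iff_apath[of 1]
  by (simp add: proper_vertex_connected_def vertex_proper_path_None_iff one_ereal_def)

lemma proper_vertex_connected_const_iff: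
  assumes "f ` verts G = {a}"
  shows "proper_vertex_connected G (Some f) \<longleftrightarrow> diam G \<le> 2"
  using diam_le_iff_apath[of 2]
  by (simp add: proper_vertex_connected_def vertex_proper_path_const_iff[OF assms])

lemma diam_ge_two:
  assumes "strongly_connected G" "\<not> diam G \<le> 1"
  shows "diam G \<ge> 2"
proof -
  obtain u v where uv: "u \<in> verts G" "v \<in> verts G" "\<not> vertex_distance G u v \<le> 1"
    using assms(2) diam_le_iff by blast
  moreover have "u \<rightarrow>\<^sup>* v" using uv assms(1) by (simp add: strongly_connected_def)
  then obtain p where "apath u p v" "vertex_distance G u v = ereal (real (length p))"
    using vertex_distance_attained by blast
  \<comment> \<open>The distance is the length of a path, and no natural number lies strictly
    between 1 and 2.\<close>
  ultimately have "vertex_distance G u v \<ge> 2" by simp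
  then show ?thesis using uv diam_le_iff[of "diam G"] by (meson order_refl order_trans)
qed

text \<open>This supplies an admissible coloring, without which the \<open>LEAST\<close> in
  \<open>pvc\<close> need not be attained.\<close>

lemma proper_vertex_connected_inj:
  assumes "strongly_connected G" "inj_on f (verts G)"
  shows "proper_vertex_connected G (Some f)"
  unfolding proper_vertex_connected_def
proof (intro ballI impI)
  fix u v assume "u \<in> verts G" "v \<in> verts G"
  then obtain p where "apath u p v"
    using assms(1) vertex_distance_attained by (metis strongly_connected_def)
  then show "\<exists>p. vertex_proper_path G (Some f) u p v"
    using vertex_proper_path_inj[OF assms(2)] by blast
qed

lemma pvc_attained:
  assumes "strongly_connected G"
  obtains c where "num_colors G c = pvc G" "proper_vertex_connected G c"
proof -
  obtain f :: "'a \<Rightarrow> nat" where "inj_on f (verts G)"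
    using finite_imp_inj_to_nat_seg[OF finite_verts] by blast
  then have "\<exists>k c. num_colors G c = k \<and> proper_vertex_connected G c"
    using proper_vertex_connected_inj[OF assms] by blast
  then have "\<exists>c. num_colors G c = pvc G \<and> proper_vertex_connected G c"
    unfolding pvc_def by (rule LeastI_ex)
  then show ?thesis using that by blast
qed

lemma pvc_le: "proper_vertex_connected G c \<Longrightarrow> pvc G \<le> num_colors G c"
  unfolding pvc_def by (auto intro: Least_le)

text \<open>On a nonempty vertex set this leaves \<open>None\<close> as the only coloring with zero
  colors.\<close>

lemma num_colors_Some_pos: "verts G \<noteq> {} \<Longrightarrow> num_colors G (Some f) > 0"
  by (simp add: num_colors_def card_gt_0_iff)

lemma pvc_eq_0_iff_diam:
  assumes "strongly_connected G"
  shows "pvc G = 0 \<longleftrightarrow> diam G \<le> 1"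
proof
  assume "pvc G = 0"
  then obtain c where c: "num_colors G c = 0" "proper_vertex_connected G c"
    using pvc_attained[OF assms] by metis
  then have "c = None"
    using assms num_colors_Some_pos by (cases c) (metis less_irrefl strongly_connected_def)+
  then show "diam G \<le> 1" using c proper_vertex_connected_None_iff by simp
next
  assume "diam G \<le> 1"
  then show "pvc G = 0"
    using pvc_le[of None] proper_vertex_connected_None_iff by (simp add: num_colors_def)
qed

lemma pvc_eq_1_iff_diam:
  assumes "strongly_connected G"
  shows "pvc G = 1 \<longleftrightarrow> diam G = 2"
proof
  assume pvc: "pvc G = 1"
  then obtain c where c: "num_colors G c = 1" "proper_vertex_connected G c"
    using pvc_attained[OF assms] by metis
  \<comment> \<open>\<open>None\<close> counts as zero colors, so a coloring with exactly one color
    has to be a genuine one.\<close>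
  then obtain f where f: "c = Some f" "card (f ` verts G) = 1"
    by (cases c) (auto simp: num_colors_def)
  then obtain a where "f ` verts G = {a}" by (elim card_1_singletonE)
  then have "diam G \<le> 2" using c f proper_vertex_connected_const_iff by blast
  \<comment> \<open>A diameter of at most 1 would force \<open>pvc G = 0\<close>; above 1, the
    diameter is at least 2.\<close>
  moreover have "diam G \<ge> 2" using pvc pvc_eq_0_iff_diam diam_ge_two assms by simp
  ultimately show "diam G = 2" by (rule antisym)
next
  assume diam: "diam G = 2"
  \<comment> \<open>Strong connectivity includes that \<open>verts G\<close> is nonempty, so the
    constant coloring uses exactly one color.\<close>
  have const: "(\<lambda>_. 0 :: nat) ` verts G = {0}" using assms by (auto simp: strongly_connected_def)
  then have "pvc G \<le> num_colors G (Some (\<lambda>_. 0))"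
    using proper_vertex_connected_const_iff diam by (intro pvc_le) auto
  then have "pvc G \<le> 1" using const by (simp add: num_colors_def)
  moreover have "pvc G \<noteq> 0" using pvc_eq_0_iff_diam[OF assms] diam by simp
  ultimately show "pvc G = 1" by simp
qed

end

lemma (in graph) complete_digraph_iff_diam:
  "complete_digraph (card (verts G)) G \<longleftrightarrow> diam G \<le> 1"
proof -
  \<comment> \<open>Between distinct vertices the empty path is excluded, so a path with at most one
    arc is a single arc.\<close>
  have apath_iff: "(\<exists>p. apath u p v \<and> length p \<le> 1) \<longleftrightarrow> u \<rightarrow>\<^bsub>G\<^esub> v" if neq: "u \<noteq> v" for u v
  proof
    assume "\<exists>p. apath u p v \<and> length p \<le> 1"
    then obtain p where "apath u p v" "length p \<le> 1" by blast
    moreover from this have "p \<noteq> []" using neq by (auto simp: apath_Nil_iff)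
    ultimately obtain e where "p = [e]" by (cases p) auto
    then show "u \<rightarrow>\<^bsub>G\<^esub> v"
      using \<open>apath u p v\<close> in_arcs_imp_in_arcs_ends by (auto simp: apath_simps)
  next
    assume "u \<rightarrow>\<^bsub>G\<^esub> v"
    then obtain e where "e \<in> arcs G" "tail G e = u" "head G e = v" by blast
    then have "apath u [e] v" using neq by (auto simp: apath_simps)
    then show "\<exists>p. apath u p v \<and> length p \<le> 1" by (intro exI[of _ "[e]"]) simp
  qed
  \<comment> \<open>Completeness is an equality of sets of pairs. Having no loops gives this
    inclusion, so only the converse one remains to be compared with the diameter.\<close>
  have "arcs_ends G \<subseteq> {(u, v). (u, v) \<in> verts G \<times> verts G \<and> u \<noteq> v}"
    using adj_in_verts adj_not_same by auto
  then have "complete_digraph (card (verts G)) G \<longleftrightarrow>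
      (\<forall>u \<in> verts G. \<forall>v \<in> verts G. u \<noteq> v \<longrightarrow> u \<rightarrow>\<^bsub>G\<^esub> v)"
    using graph_axioms unfolding complete_digraph_def by auto
  also have "\<dots> \<longleftrightarrow> diam G \<le> 1"
    using diam_le_iff_apath[of 1] apath_iff by (simp add: one_ereal_def)
  finally show ?thesis .
qed

theorem proposition1:
  fixes G :: "('a, 'b) pre_digraph"
  assumes "graph G"
    and "Digraph_Component.connected G"
    and "card (verts G) \<ge> 2"
  shows "(pvc G = 0 \<longleftrightarrow> complete_digraph (card (verts G)) G) \<and>
         (pvc G = 1 \<longleftrightarrow> diam G = 2)"
proof -
  interpret graph G by fact
  \<comment> \<open>Connectedness ignores the direction of arcs; since every arc has its opposite,
    it yields directed reachability.\<close>
  have "strongly_connected G"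
    using assms(2) sym_arcs symmetric_connected_imp_strongly_connected by blast
  then show ?thesis
    using pvc_eq_0_iff_diam pvc_eq_1_iff_diam complete_digraph_iff_diam by simp
qed

end
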